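(* Let $k\ge 2$, $m\in\mathbb{N}$, and $n_1,\dots,n_m\in\mathbb{N}$ with $n_i\ge 2k$ for all $1\le i\le m$. Let $G=\bigcup_{i=1}^m C_{n_i}$ be the disjoint union of cycles. Then $G$ is $k$-distance magic if and only if $n_i=4k$ for every $i$, $1\le i\le m$.
   Context: All graphs are finite, simple and undirected; $d(u,v)$ is graph distance ($\infty$ between different components). For $u\in V(G)$ and $k\in\mathbb{N}$, $\partial N_k(u)=\{v\in V(G): d(u,v)=k\}$. For a graph $G$ of order $n\ge3$, a $k$-distance magic labeling ($k$-DML) is a bijection $f:V(G)\to\{1,\dots,n\}$ such that $\sum_{w\in\partial N_k(u)} f(w)$ is a constant independent of $u\in V(G)$. $G$ is $k$-distance magic ($k$-DM) if it has a $k$-DML. *)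

theory Defs
  imports "Graph_Theory.Graph_Theory"
begin

text \<open>
  Finite simple undirected graphs are the symmetric, loop-free, finite digraphs without parallel
  arcs of \<^locale>\<open>graph\<close> (on pairs: \<^locale>\<open>pair_graph\<close>); an edge \<open>uv\<close> is the pair of arcs
  \<open>(u, v)\<close>, \<open>(v, u)\<close>.  The definitions taking a graph are meant for well-formed arguments only:
  the library's shortest path length \<open>wf_digraph.\<mu>\<close> is specified only for these.
\<close>

text \<open>With unit arc weights \<open>\<mu>\<close> is the graph distance, infinite between different components.\<close>

definition graph_dist :: "('a, 'b) pre_digraph \<Rightarrow> 'a \<Rightarrow> 'a \<Rightarrow> ereal" where
  "graph_dist G u v = wf_digraph.\<mu> G (\<lambda>_. 1) u v"

definition dist_sphere :: "('a, 'b) pre_digraph \<Rightarrow> nat \<Rightarrow> 'a \<Rightarrow> 'a set" where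
  "dist_sphere G k u = {v \<in> verts G. graph_dist G u v = ereal (real k)}"

definition k_distance_magic_labeling ::
    "nat \<Rightarrow> ('a, 'b) pre_digraph \<Rightarrow> ('a \<Rightarrow> nat) \<Rightarrow> bool" where
  "k_distance_magic_labeling k G f \<longleftrightarrow>
     3 \<le> card (verts G) \<and>
     bij_betw f (verts G) {1..card (verts G)} \<and>
     (\<exists>c. \<forall>u \<in> verts G. (\<Sum>w \<in> dist_sphere G k u. f w) = c)"

definition k_distance_magic :: "nat \<Rightarrow> ('a, 'b) pre_digraph \<Rightarrow> bool" where
  "k_distance_magic k G \<longleftrightarrow> (\<exists>f. k_distance_magic_labeling k G f)"

text \<open>The cycle on \<open>{0..<n}\<close>; a simple graph, and the cycle of length \<open>n\<close>, only for \<open>n \<ge> 3\<close>.\<close>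

definition cycle_graph :: "nat \<Rightarrow> nat pair_pre_digraph" where
  "cycle_graph n = \<lparr> pverts = {0..<n},
     parcs = {(i, j). i < n \<and> j < n \<and> (j = (i + 1) mod n \<or> i = (j + 1) mod n)} \<rparr>"

definition disjoint_union ::
    "'i set \<Rightarrow> ('i \<Rightarrow> 'a pair_pre_digraph) \<Rightarrow> ('i \<times> 'a) pair_pre_digraph" where
  "disjoint_union I H = \<lparr> pverts = (SIGMA i:I. pverts (H i)),
     parcs = {((i, u), (i, v)) | i u v. i \<in> I \<and> (u, v) \<in> parcs (H i)} \<rparr>"

lemma pair_graph_cycle_graph:
  assumes "3 \<le> n"
  shows "pair_graph (cycle_graph n)"
proof
  show "finite (parcs (cycle_graph n))"
    by (rule finite_subset[of _ "{0..<n} \<times> {0..<n}"]) (auto simp: cycle_graph_def)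
  show "symmetric (with_proj (cycle_graph n))"
    by (auto simp: symmetric_def sym_def cycle_graph_def)
  show "fst e \<noteq> snd e" if "e \<in> parcs (cycle_graph n)" for e
    using that assms by (auto simp: cycle_graph_def mod_Suc split: if_splits)
qed (auto simp: cycle_graph_def)

lemma pair_graph_disjoint_union:
  assumes "finite I" and H: "\<And>i. i \<in> I \<Longrightarrow> pair_graph (H i)"
  shows "pair_graph (disjoint_union I H)"
proof
  have wf: "u \<in> pverts (H i) \<and> v \<in> pverts (H i) \<and> u \<noteq> v \<and> (v, u) \<in> parcs (H i)"
    if "i \<in> I" "(u, v) \<in> parcs (H i)" for i u v
  proof -
    interpret pair_graph "H i" by (rule H[OF that(1)])
    show ?thesis
      using that(2) in_arcsD1 in_arcsD2 pair_no_loops pair_sym_arcs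
      by (fastforce simp: symmetric_def sym_def)
  qed
  show fin: "finite (pverts (disjoint_union I H))"
    using assms by (auto simp: disjoint_union_def pair_graph_def pair_digraph_def
        pair_fin_digraph_def pair_fin_digraph_axioms_def)
  show "fst e \<in> pverts (disjoint_union I H)" "snd e \<in> pverts (disjoint_union I H)"
    "fst e \<noteq> snd e" if "e \<in> parcs (disjoint_union I H)" for e
    using that wf by (auto simp: disjoint_union_def)
  then show "finite (parcs (disjoint_union I H))"
    by (intro finite_subset[OF _ finite_cartesian_product[OF fin fin]]) force
  show "symmetric (with_proj (disjoint_union I H))"
    using wf by (auto simp: symmetric_def sym_def disjoint_union_def)
qed

end

theory Submission
  imports Defs
begin

text \<open>
  In a cycle of length \<open>n \<ge> 2k\<close> the vertices at distance \<open>k\<close> from \<open>u\<close> are \<open>u + k\<close> and \<open>u - k\<close>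
  modulo \<open>n\<close>.  If \<open>n = 2k\<close> these coincide, so all labels on that cycle are equal, which is absurd.
  If \<open>n > 2k\<close>, then \<open>f v + f (v + 2k)\<close> is constant, so \<open>f (v + 4k) = f v\<close>; injectivity gives
  \<open>n dvd 4k\<close> and hence \<open>n = 4k\<close>.  Conversely, for \<open>n = 4k\<close> it suffices to give antipodal vertices
  labels with sum \<open>4km + 1\<close>.
\<close>

section \<open>Distance as least walk length; adjacency as integer displacement\<close>

lemma (in wf_digraph) awalk_cost_unit: "awalk_cost (\<lambda>_. 1) p = real (length p)"
  by (induction p) simp_all

text \<open>The distance is an infimum of natural numbers, attained as soon as a walk exists;
  without walks it is infinite and both sides fail.\<close>

lemma graph_dist_eq_iff:
  assumes wf: "wf_digraph G"
  shows "graph_dist G u v = ereal (real k) \<longleftrightarrow>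
    (\<exists>p. pre_digraph.awalk G u p v \<and> length p = k) \<and>
    (\<forall>p. pre_digraph.awalk G u p v \<longrightarrow> k \<le> length p)"
proof -
  let ?W = "{p. pre_digraph.awalk G u p v}"
  have dist: "graph_dist G u v = (INF p\<in>?W. ereal (real (length p)))"
    by (simp add: graph_dist_def wf_digraph.\<mu>_def[OF wf] wf_digraph.awalk_cost_unit[OF wf])
  show ?thesis
  proof (cases "?W = {}")
    case True
    then show ?thesis by (simp add: dist top_ereal_def)
  next
    case False
    then obtain p where p: "p \<in> ?W" "\<And>q. q \<in> ?W \<Longrightarrow> length p \<le> length q"
      using ex_has_least_nat[of "\<lambda>p. p \<in> ?W" _ length] by blast
    have "graph_dist G u v = ereal (real (length p))"
      unfolding dist by (rule INF_eqI) (use p in auto)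
    then show ?thesis using p by (auto intro: le_antisym)
  qed
qed

text \<open>Over the integers the two directions of an edge become displacements 1 and -1, with no
  truncated subtraction.\<close>

lemma cycle_graph_arc_iff:
  assumes "0 < n"
  shows "(u, v) \<in> parcs (cycle_graph n) \<longleftrightarrow> u < n \<and> v < n \<and>
    (int v = (int u + 1) mod int n \<or> int v = (int u - 1) mod int n)"
proof -
  have "(v = (u + 1) mod n) = (int v = (int u + 1) mod int n)"
    by (metis of_nat_1 of_nat_add of_nat_eq_iff of_nat_mod)
  moreover have "(u = (v + 1) mod n) = (int v = (int u - 1) mod int n)" if "u < n" "v < n"
  proof -
    have "(u = (v + 1) mod n) = (int u mod int n = (int v + 1) mod int n)"
      using that by (metis of_nat_1 of_nat_add of_nat_eq_iff of_nat_mod mod_less)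
    also have "\<dots> = ((int u - 1) mod int n = int v mod int n)"
      by (simp add: mod_eq_dvd_iff algebra_simps)
    finally show ?thesis using that by auto
  qed
  ultimately show ?thesis by (auto simp: cycle_graph_def)
qed

section \<open>Walks and distance spheres in a disjoint union of cycles\<close>

locale cycle_union =
  fixes I :: "'i set" and n :: "'i \<Rightarrow> nat"
  assumes finite_index: "finite I" and length_ge: "i \<in> I \<Longrightarrow> 3 \<le> n i"
begin

abbreviation "G \<equiv> with_proj (disjoint_union I (\<lambda>i. cycle_graph (n i)))"

sublocale pair_graph "disjoint_union I (\<lambda>i. cycle_graph (n i))"
  by (intro pair_graph_disjoint_union pair_graph_cycle_graph finite_index length_ge)

lemma verts_G: "pverts (disjoint_union I (\<lambda>i. cycle_graph (n i))) = (SIGMA i:I. {0..<n i})"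
  by (simp add: disjoint_union_def cycle_graph_def)

lemma arc_G_iff:
  "((i, u), (j, v)) \<in> arcs G \<longleftrightarrow> j = i \<and> i \<in> I \<and> u < n i \<and> v < n i \<and>
    (int v = (int u + 1) mod int (n i) \<or> int v = (int u - 1) mod int (n i))"
proof -
  have "((i, u), (j, v)) \<in> arcs G \<longleftrightarrow> j = i \<and> i \<in> I \<and> (u, v) \<in> parcs (cycle_graph (n i))"
    by (auto simp: disjoint_union_def)
  then show ?thesis
    using length_ge[of i] by (auto simp: cycle_graph_arc_iff)
qed

text \<open>Every arc stays in its cycle and contributes 1 or -1 to the total displacement. This
  bounds distances from below.\<close>

lemma awalk_displacement:
  assumes "awalk (i, u) p (j, v)"
  shows "j = i \<and> (\<exists>z. \<bar>z\<bar> \<le> int (length p) \<and> int v = (int u + z) mod int (n i))"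
  using assms
proof (induction p arbitrary: i u)
  case Nil
  then have "j = i" "u = v" "u < n i"
    by (auto simp: awalk_Nil_iff verts_G)
  then show ?case by (auto intro!: exI[of _ 0])
next
  case (Cons e p)
  obtain i' u' where e: "e = ((i, u), (i', u'))"
    using Cons.prems by (cases e) (auto simp: awalk_Cons_iff)
  have arc: "((i, u), (i', u')) \<in> arcs G" and walk: "awalk (i', u') p (j, v)"
    using Cons.prems by (auto simp: awalk_Cons_iff e)
  obtain s where s: "\<bar>s\<bar> = 1" "int u' = (int u + s) mod int (n i)" and i': "i' = i"
    using arc unfolding arc_G_iff by (metis abs_1 abs_minus diff_conv_add_uminus)
  obtain z where z: "\<bar>z\<bar> \<le> int (length p)" "int v = (int u' + z) mod int (n i)" and "j = i"
    using Cons.IH[OF walk] i' by auto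
  have "int v = (int u + (s + z)) mod int (n i)"
    by (simp add: z s mod_simps add.assoc)
  moreover have "\<bar>s + z\<bar> \<le> int (length (e # p))"
    using s z by simp
  ultimately show ?case using \<open>j = i\<close> by blast
qed

text \<open>The walk takes all \<open>l\<close> steps in the one direction \<open>s\<close>,
  possibly winding around the cycle. This bounds distances from above.\<close>

lemma ex_awalk_displacement:
  assumes "i \<in> I" "u < n i" "v < n i" "\<bar>s\<bar> = 1" "int v = (int u + int l * s) mod int (n i)"
  shows "\<exists>p. awalk (i, u) p (i, v) \<and> length p = l"
  using assms(2,3,5)
proof (induction l arbitrary: u)
  case 0
  then show ?case
    using assms(1) by (auto simp: awalk_Nil_iff verts_G)
next
  case (Suc l)
  define u' where "u' = nat ((int u + s) mod int (n i))"
  have pos: "0 < int (n i)" using Suc.prems by simp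
  have u': "int u' = (int u + s) mod int (n i)" "u' < n i"
    using pos by (simp_all add: u'_def nat_less_iff)
  have "int v = (int u' + int l * s) mod int (n i)"
    by (simp add: u' Suc.prems mod_simps algebra_simps)
  then obtain p where p: "awalk (i, u') p (i, v)" "length p = l"
    using Suc.IH u'(2) Suc.prems(2) by blast
  have "((i, u), (i, u')) \<in> arcs G"
    unfolding arc_G_iff using assms(1,4) Suc.prems u' by (auto simp: abs_if split: if_splits)
  then have "awalk (i, u) (((i, u), (i, u')) # p) (i, v)"
    using p by (simp add: awalk_Cons_iff)
  then show ?case using p(2) by (metis length_Cons)
qed

text \<open>A shorter walk would have a displacement \<open>z\<close> congruent to
  \<open>k * s\<close> with |z| < k, but then 0 < |k * s - z| < 2 * k \<le>
  \<open>n i\<close>.\<close>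

lemma graph_dist_eqI:
  assumes "i \<in> I" "u < n i" "v < n i" "2 * k \<le> n i" "\<bar>s\<bar> = 1"
    and v: "int v = (int u + int k * s) mod int (n i)"
  shows "graph_dist G (i, u) (i, v) = ereal (real k)"
proof -
  have "k \<le> length p" if walk: "awalk (i, u) p (i, v)" for p
  proof (rule ccontr)
    assume "\<not> k \<le> length p"
    moreover obtain z where "\<bar>z\<bar> \<le> int (length p)" and zv: "int v = (int u + z) mod int (n i)"
      using awalk_displacement[OF walk] by blast
    ultimately have z: "\<bar>z\<bar> < int k" by linarith
    have "int (n i) dvd (int u + int k * s) - (int u + z)"
      using v zv unfolding mod_eq_dvd_iff[symmetric] by simp
    then have "int (n i) dvd int k * s - z" by simp
    moreover have s: "s = 1 \<or> s = - 1" using assms(5) by linarith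
    then have "\<bar>int k * s - z\<bar> < int (n i)" "int k * s - z \<noteq> 0"
      using z assms(4) by auto
    ultimately show False
      using zdvd_not_zless[of "\<bar>int k * s - z\<bar>" "int (n i)"] by simp
  qed
  then show ?thesis
    using ex_awalk_displacement[OF assms(1-3,5) v] by (simp add: graph_dist_eq_iff[OF wf_digraph])
qed

lemma dist_sphere_G:
  assumes i: "i \<in> I" and u: "u < n i" and k: "2 * k \<le> n i"
  shows "dist_sphere G k (i, u) = {(i, (u + k) mod n i), (i, (u + (n i - k)) mod n i)}"
proof -
  have plus: "int ((u + k) mod n i) = (int u + int k * 1) mod int (n i)"
    by (simp add: of_nat_mod)
  have minus: "int ((u + (n i - k)) mod n i) = (int u + int k * (- 1)) mod int (n i)"
  proof -
    have "int ((u + (n i - k)) mod n i) = ((int u - int k) + int (n i)) mod int (n i)"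
      using k by (simp add: of_nat_mod of_nat_diff algebra_simps)
    then show ?thesis by simp
  qed
  have lt: "x mod n i < n i" for x
    using u by simp
  show ?thesis
  proof (intro set_eqI iffI)
    fix w assume "w \<in> dist_sphere G k (i, u)"
    then obtain j v where w: "w = (j, v)"
      and dist: "graph_dist G (i, u) (j, v) = ereal (real k)"
      by (cases w) (auto simp: dist_sphere_def)
    obtain p where p: "awalk (i, u) p (j, v)" "length p = k"
      and min: "\<And>q. awalk (i, u) q (j, v) \<Longrightarrow> k \<le> length q"
      using dist unfolding graph_dist_eq_iff[OF wf_digraph] by blast
    obtain z where z: "\<bar>z\<bar> \<le> int k" "int v = (int u + z) mod int (n i)" and j: "j = i"
      using awalk_displacement[OF p(1)] p(2) by blast
    have v: "v < n i" using z(2) u pos_mod_bound[of "int (n i)" "int u + z"] by linarith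
    \<comment> \<open>The sign of \<open>z\<close>, but 1 at \<open>z = 0\<close>, so that |s| = 1
      always holds.\<close>
    define s where "s = (if z \<ge> 0 then 1 else - 1 :: int)"
    have s: "z = int (nat \<bar>z\<bar>) * s" "\<bar>s\<bar> = 1" by (auto simp: s_def)
    \<comment> \<open>The one-directional walk of |z| steps has the same end, so minimality applies
      to it.\<close>
    have "k \<le> nat \<bar>z\<bar>"
      using ex_awalk_displacement[OF i u v s(2), of "nat \<bar>z\<bar>"] z(2) s(1) min j by metis
    then have "z = int k * 1 \<or> z = int k * (- 1)" using z(1) by linarith
    then have "v = (u + k) mod n i \<or> v = (u + (n i - k)) mod n i"
      using z(2) plus minus by (metis of_nat_eq_iff)
    then show "w \<in> {(i, (u + k) mod n i), (i, (u + (n i - k)) mod n i)}"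
      by (auto simp: w j)
  next
    fix w assume w: "w \<in> {(i, (u + k) mod n i), (i, (u + (n i - k)) mod n i)}"
    have "graph_dist G (i, u) (i, (u + k) mod n i) = ereal (real k)"
      by (rule graph_dist_eqI[OF i u lt k _ plus]) simp
    moreover have "graph_dist G (i, u) (i, (u + (n i - k)) mod n i) = ereal (real k)"
      by (rule graph_dist_eqI[OF i u lt k _ minus]) simp
    ultimately show "w \<in> dist_sphere G k (i, u)"
      using w i lt by (auto simp: dist_sphere_def verts_G)
  qed
qed

section \<open>Necessity of length \<open>4 * k\<close>\<close>

lemma magic_imp_length_eq:
  assumes magic: "k_distance_magic_labeling k G f" and i: "i \<in> I" and k: "0 < k" "2 * k \<le> n i"
  shows "n i = 4 * k"
proof -
  let ?N = "n i"
  have N: "0 < ?N" using k by linarith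
  have inj: "inj_on f (verts G)"
    using magic by (auto simp: k_distance_magic_labeling_def bij_betw_def)
  have f_inj: "a = b" if "f (i, a) = f (i, b)" "a < ?N" "b < ?N" for a b
    using inj_onD[OF inj that(1)] that i by (simp add: verts_G)
  obtain c where "\<forall>u\<in>verts G. (\<Sum>w\<in>dist_sphere G k u. f w) = c"
    using magic by (auto simp: k_distance_magic_labeling_def)
  then have c: "(\<Sum>w\<in>{(i, (u + k) mod ?N), (i, (u + (?N - k)) mod ?N)}. f w) = c" if "u < ?N" for u
    unfolding dist_sphere_G[OF i that k(2), symmetric] using that i by (simp add: verts_G)
  have shift: "((v + k) mod ?N + (?N - k)) mod ?N = v" "((v + k) mod ?N + k) mod ?N = (v + 2 * k) mod ?N"
    if "v < ?N" for v
  proof -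
    have "((v + k) mod ?N + (?N - k)) mod ?N = (v + k + (?N - k)) mod ?N"
      by (rule mod_add_left_eq)
    also have "v + k + (?N - k) = v + ?N" using k by linarith
    finally show "((v + k) mod ?N + (?N - k)) mod ?N = v" using that by simp
    show "((v + k) mod ?N + k) mod ?N = (v + 2 * k) mod ?N"
      by (simp add: mod_simps mult_2 add.assoc)
  qed
  \<comment> \<open>The sphere around \<open>v + k\<close> consists of \<open>v + 2 * k\<close> and
    \<open>v\<close>. The sum runs over a set, so coinciding vertices count once.\<close>
  have c': "(\<Sum>w\<in>{(i, (v + 2 * k) mod ?N), (i, v)}. f w) = c" if "v < ?N" for v
    using c[of "(v + k) mod ?N"] shift[OF that] N by simp
  show ?thesis
  proof (cases "?N = 2 * k")
    case True
    have f_eq: "f (i, v) = c" if "v < ?N" for v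
      using c'[OF that] that unfolding True[symmetric] by simp
    have "1 < ?N" using True k by linarith
    then have "(0::nat) = 1" using f_inj[of 0 1] f_eq[of 0] f_eq[of 1] N by simp
    then show ?thesis by simp
  next
    case False
    then have lt: "2 * k < ?N" using k by simp
    have "f (i, 2 * k) + f (i, 0) = c"
      using c'[of 0] lt k by simp
    \<comment> \<open>The two vertices must be distinct for the sum over the set to split into two
      terms.\<close>
    moreover have "(2 * k + 2 * k) mod ?N \<noteq> 2 * k"
    proof
      assume "(2 * k + 2 * k) mod ?N = 2 * k"
      then have "(2 * k + 2 * k) mod ?N = 2 * k mod ?N" using lt by simp
      then have "?N dvd 2 * k" by (subst (asm) mod_eq_dvd_iff_nat) simp_all
      then show False using lt k by (auto dest: nat_dvd_not_less)
    qed
    then have "f (i, (2 * k + 2 * k) mod ?N) + f (i, 2 * k) = c"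
      using c'[of "2 * k"] lt by simp
    ultimately have "f (i, (2 * k + 2 * k) mod ?N) = f (i, 0)" by linarith
    then have "(2 * k + 2 * k) mod ?N = 0"
      using f_inj N by simp
    then obtain q where q: "4 * k = ?N * q" by auto
    \<comment> \<open>Since 4k < 2N, the multiple \<open>q\<close> is below 2, and k > 0 excludes
      0.\<close>
    then have "?N * q < ?N * 2" using lt by linarith
    moreover have "q \<noteq> 0" using q k by (intro notI) simp
    ultimately have "q = 1" by simp
    then show ?thesis using q by simp
  qed
qed

end

section \<open>A labeling for cycles of length \<open>4 * k\<close>\<close>

lemma block_index_less:
  fixes i j :: nat
  assumes "i \<in> {1..m}" "v < b"
  shows "(i - 1) * b + v < m * b"
proof -
  have "(i - 1) * b + v < (i - 1) * b + b" using assms by simp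
  also have "\<dots> = i * b" using assms by (cases i) auto
  also have "\<dots> \<le> m * b" using assms by simp
  finally show ?thesis .
qed

text \<open>The first halves of the cycles take the labels 1 to 2km in order, cycle after cycle;
  each antipode takes the complement to 4km + 1. Cycles are numbered from 1, hence
  \<open>i - 1\<close>.\<close>

definition antipodal_labeling :: "nat \<Rightarrow> nat \<Rightarrow> nat \<times> nat \<Rightarrow> nat" where
  "antipodal_labeling k m = (\<lambda>(i, u).
     if u < 2 * k then (i - 1) * (2 * k) + u + 1
     else 4 * k * m - ((i - 1) * (2 * k) + (u - 2 * k)))"

lemma antipodal_labeling_sum:
  assumes "i \<in> {1..m}" "v < 2 * k"
  shows "antipodal_labeling k m (i, v) + antipodal_labeling k m (i, v + 2 * k) = 4 * k * m + 1"
proof -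
  \<comment> \<open>This keeps the truncated subtraction in the labeling exact.\<close>
  have "(i - 1) * (2 * k) + v < 2 * (k * m)"
    using block_index_less[OF assms] by (simp add: mult.commute mult.left_commute)
  then show ?thesis
    using assms(2) by (simp add: antipodal_labeling_def)
qed

text \<open>First halves get labels up to 2km, second halves larger ones. Within a half, the label
  determines cycle and vertex. Surjectivity follows by counting.\<close>

lemma bij_betw_antipodal_labeling:
  "bij_betw (antipodal_labeling k m) ({1..m} \<times> {0..<4 * k}) {1..4 * k * m}"
proof -
  let ?f = "antipodal_labeling k m" and ?V = "{1..m} \<times> {0..<4 * k}"
  let ?g = "\<lambda>i u. (i - 1) * (2 * k) + u"
  have g_inj: "i = j \<and> u = v" if "?g i u = ?g j v" "i \<in> {1..m}" "j \<in> {1..m}" "u < 2 * k" "v < 2 * k"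
    for i j u v
  proof -
    \<comment> \<open>Quotient and remainder by \<open>2 * k\<close> recover the cycle and the
      vertex.\<close>
    have "i - 1 = ?g i u div (2 * k)" "j - 1 = ?g j v div (2 * k)" "u = ?g i u mod (2 * k)" "v = ?g j v mod (2 * k)"
      using that(4,5) by simp_all
    then have "i - 1 = j - 1" "u = v" using that(1) by metis+
    then show ?thesis using that(2,3) by auto
  qed
  have low: "?f (i, u) = ?g i u + 1" "?g i u < 2 * k * m" if "i \<in> {1..m}" "u < 2 * k" for i u
    using that block_index_less[OF that] by (simp_all add: antipodal_labeling_def mult.commute)
  have high: "?f (i, u) = 4 * k * m - ?g i (u - 2 * k)" "?g i (u - 2 * k) < 2 * k * m"
    "u - 2 * k < 2 * k"
    if "i \<in> {1..m}" "\<not> u < 2 * k" "u < 4 * k" for i u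
    using that block_index_less[of i m "u - 2 * k" "2 * k"]
    by (simp_all add: antipodal_labeling_def mult.commute)
  have "inj_on ?f ?V"
  proof (rule inj_onI, clarify)
    fix i u j v
    assume a: "i \<in> {1..m}" "u \<in> {0..<4 * k}" "j \<in> {1..m}" "v \<in> {0..<4 * k}" and eq: "?f (i, u) = ?f (j, v)"
    then have b: "u < 4 * k" "v < 4 * k" by simp_all
    consider "u < 2 * k" "v < 2 * k" | "u < 2 * k" "\<not> v < 2 * k"
      | "\<not> u < 2 * k" "v < 2 * k" | "\<not> u < 2 * k" "\<not> v < 2 * k" by blast
    then show "i = j \<and> u = v"
    proof cases
      case 1
      then show ?thesis using low(1)[OF a(1) 1(1)] low(1)[OF a(3) 1(2)] eq
        by (intro g_inj a) simp_all
    next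
      case 2
      then show ?thesis using low[OF a(1) 2(1)] high[OF a(3) 2(2) b(2)] eq by linarith
    next
      case 3
      then show ?thesis using low[OF a(3) 3(2)] high[OF a(1) 3(1) b(1)] eq by linarith
    next
      case 4
      note h = high[OF a(1) 4(1) b(1)] high[OF a(3) 4(2) b(2)]
      have "i = j \<and> u - 2 * k = v - 2 * k"
        by (intro g_inj a h) (use h eq in linarith)
      then show ?thesis using 4 by auto
    qed
  qed
  moreover have "?f ` ?V \<subseteq> {1..4 * k * m}"
  proof (clarify, goal_cases)
    case (1 _ i u)
    then show ?case using low[of i u] high[of i u] by (cases "u < 2 * k") auto
  qed
  ultimately show ?thesis
    by (intro bij_betw_imageI card_subset_eq) (auto simp: card_image)
qed

text \<open>Modulo 4k, u + k and u - k differ by 2k, hence are antipodal; \<open>v\<close> is the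
  smaller residue. The cases record which of the two sums wraps around.\<close>

lemma mod_double_antipodal:
  fixes k u :: nat
  assumes "u < 4 * k"
  obtains v where "v < 2 * k"
    "{(u + k) mod (4 * k), (u + (4 * k - k)) mod (4 * k)} = {v, v + 2 * k}"
proof -
  consider "u < k" | "k \<le> u" "u < 3 * k" | "3 * k \<le> u" by linarith
  then show thesis
  proof cases
    case 1
    then show thesis by (intro that[of "u + k"]) auto
  next
    case 2
    then have "(u + k) mod (4 * k) = u + k" "(u + (4 * k - k)) mod (4 * k) = u - k"
      using assms by (auto simp: mod_if)
    then show thesis using 2 by (intro that[of "u - k"]) auto
  next
    case 3
    then have "(u + k) mod (4 * k) = u - 3 * k" "(u + (4 * k - k)) mod (4 * k) = u - k"
      using assms by (auto simp: mod_if)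
    then show thesis using 3 assms by (intro that[of "u - 3 * k"]) auto
  qed
qed

theorem theorem2p7:
  fixes k m :: nat and n :: "nat \<Rightarrow> nat"
  assumes "2 \<le> k" and "1 \<le> m" and "\<And>i. i \<in> {1..m} \<Longrightarrow> 2 * k \<le> n i"
  shows "k_distance_magic k (with_proj (disjoint_union {1..m} (\<lambda>i. cycle_graph (n i))))
    \<longleftrightarrow> (\<forall>i \<in> {1..m}. n i = 4 * k)"
proof -
  interpret cycle_union "{1..m}" n
  proof
    show "3 \<le> n i" if "i \<in> {1..m}" for i
      using assms(3)[OF that] assms(1) by linarith
  qed simp
  show ?thesis
  proof
    assume "k_distance_magic k G"
    then show "\<forall>i\<in>{1..m}. n i = 4 * k"
      using magic_imp_length_eq assms by (fastforce simp: k_distance_magic_def)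
  next
    assume n: "\<forall>i\<in>{1..m}. n i = 4 * k"
    then have V: "verts G = {1..m} \<times> {0..<4 * k}"
      unfolding with_proj_simps verts_G by (intro Sigma_cong) auto
    have card_V: "card ({1..m} \<times> {0..<4 * k}) = 4 * k * m"
      by simp
    have "1 * 8 \<le> m * (4 * k)" using assms(1,2) by (intro mult_le_mono) auto
    then have "3 \<le> 4 * k * m" by (simp add: mult.commute mult.left_commute)
    moreover have "(\<Sum>w\<in>dist_sphere G k (i, u). antipodal_labeling k m w) = 4 * k * m + 1"
      if i: "i \<in> {1..m}" and u: "u < 4 * k" for i u
    proof -
      obtain v where v: "v < 2 * k"
        "{(u + k) mod (4 * k), (u + (4 * k - k)) mod (4 * k)} = {v, v + 2 * k}"
        using mod_double_antipodal[OF u] .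
      \<comment> \<open>The image form lets the equation of unordered pairs be rewritten as a
        whole.\<close>
      have "dist_sphere G k (i, u) = Pair i ` {(u + k) mod (4 * k), (u + (4 * k - k)) mod (4 * k)}"
        using dist_sphere_G[OF i, of u k] n[rule_format, OF i] u by auto
      also have "\<dots> = {(i, v), (i, v + 2 * k)}" unfolding v by simp
      \<comment> \<open>Here k > 0 makes \<open>v\<close> and \<open>v + 2 * k\<close> distinct, so
        both labels are summed.\<close>
      finally show ?thesis
        using antipodal_labeling_sum[OF i v(1)] assms(1) by simp
    qed
    ultimately have "k_distance_magic_labeling k G (antipodal_labeling k m)"
      unfolding k_distance_magic_labeling_def V card_V
      by (intro conjI bij_betw_antipodal_labeling exI[of _ "4 * k * m + 1"]) auto
    then show "k_distance_magic k G" by (auto simp: k_distance_magic_def)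
  qed
qed

end
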